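(* For every environment $\Gamma$ (finite multiset of formulas), if $\vdash \Gamma$ is derivable in classical linear logic (CLL), then $\vdash \Gamma$ (the hyperenvironment consisting of the single environment $\Gamma$) is derivable in the type-only HCP sequent system.
   Context: Formulas: $A,B ::= A\otimes B \mid A ⅋ B \mid A\oplus B \mid A\&B \mid 1\mid\bot\mid ?A\mid !A$, with involutive duality $(A\otimes B)^\perp = A^\perp ⅋ B^\perp$, $(A\oplus B)^\perp = A^\perp \& B^\perp$, $1^\perp = \bot$, $(?A)^\perp = !A^\perp$ (and symmetrically). Environments $\Gamma,\Delta$ are finite unordered multisets of formulas; $?\Gamma$ denotes one whose formulas all have the form $?B$. CLL is Girard's one-sided sequent calculus (without Mix): $\vdash A^\perp, A$; Cut: from $\vdash\Gamma,A$ and $\vdash\Delta,A^\perp$ infer $\vdash\Gamma,\Delta$; $\otimes$: from $\vdash\Gamma,A$ and $\vdash\Delta,B$ infer $\vdash\Gamma,\Delta,A\otimes B$; ⅋: from $\vdash \Gamma,A,B$ infer $\vdash\Gamma,A⅋B$; $\vdash 1$; $\bot$: from $\vdash\Gamma$ infer $\vdash\Gamma,\bot$; $\oplus_i$: from $\vdash\Gamma,A_i$ infer $\vdash\Gamma,A_1\oplus A_2$; $\&$: from $\vdash\Gamma,A$ and $\vdash\Gamma,B$ infer $\vdash\Gamma,A\&B$; $!$: from $\vdash ?\Gamma,A$ infer $\vdash ?\Gamma,!A$; $?$: from $\vdash\Gamma,A$ infer $\vdash\Gamma,?A$; weakening: from $\vdash\Gamma$ infer $\vdash\Gamma,?A$;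 contraction: from $\vdash\Gamma,?A,?A$ infer $\vdash\Gamma,?A$. A hyperenvironment $\mathcal{G}=\Gamma_1\mid\cdots\mid\Gamma_n$ is an unordered collection of environments ($\varnothing$ the empty one). The type-only HCP system derives $\vdash \mathcal{G}$ by: (Ax) $\vdash A^\perp,A$; (H-Cut) from $\vdash \mathcal{G}\mid\Gamma,A\mid\Delta,A^\perp$ infer $\vdash\mathcal{G}\mid\Gamma,\Delta$; (H-Mix) from $\vdash\mathcal{G}$ and $\vdash\mathcal{H}$ infer $\vdash\mathcal{G}\mid\mathcal{H}$; (H-Mix$_0$) $\vdash\varnothing$; ($\otimes$) from $\vdash\mathcal{G}\mid\Gamma,A\mid\Delta,B$ infer $\vdash\mathcal{G}\mid\Gamma,\Delta,A\otimes B$; ($1$) from $\vdash\mathcal{G}$ infer $\vdash\mathcal{G}\mid 1$; (⅋) from $\vdash\mathcal{G}\mid\Gamma,A,B$ infer $\vdash\mathcal{G}\mid\Gamma,A⅋B$; ($\bot$) from $\vdash\mathcal{G}\mid\Gamma$ infer $\vdash\mathcal{G}\mid\Gamma,\bot$; ($\oplus_i$) from $\vdash\mathcal{G}\mid\Gamma,A_i$ infer $\vdash\mathcal{G}\mid\Gamma,A_1\oplus A_2$; ($\&$) from $\vdash\Gamma,A$ and $\vdash\Gamma,B$ infer $\vdash\Gamma,A\&B$; ($!$) from $\vdash ?\Gamma,A$ infer $\vdash ?\Gamma,!A$; ($?$) from $\vdash\mathcal{G}\mid\Gamma,A$ infer $\vdash\mathcal{G}\mid\Gamma,?A$; (W)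 from $\vdash\mathcal{G}\mid\Gamma$ infer $\vdash\mathcal{G}\mid\Gamma,?A$; (C) from $\vdash\mathcal{G}\mid\Gamma,?A,?A$ infer $\vdash\mathcal{G}\mid\Gamma,?A$. *)

theory Defs
  imports "HOL-Library.Multiset"
begin

datatype formula =
    Tensor formula formula
  | Par formula formula
  | Plus formula formula
  | With formula formula
  | One
  | Bot
  | WhyNot formula
  | OfCourse formula

primrec dual :: "formula \<Rightarrow> formula" where
  "dual (Tensor A B) = Par (dual A) (dual B)"
| "dual (Par A B) = Tensor (dual A) (dual B)"
| "dual (Plus A B) = With (dual A) (dual B)"
| "dual (With A B) = Plus (dual A) (dual B)"
| "dual One = Bot"
| "dual Bot = One"
| "dual (WhyNot A) = OfCourse (dual A)"
| "dual (OfCourse A) = WhyNot (dual A)"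

lemma dual_dual [simp]: "dual (dual A) = A"
  by (induction A) simp_all

type_synonym env = "formula multiset"

text \<open>The empty hyperenvironment \<^term>\<open>{#}\<close> and the hyperenvironment
  \<^term>\<open>{#{#}#}\<close>, whose only component is the empty environment, are different.\<close>

type_synonym hyperenv = "env multiset"

definition whynot_env :: "env \<Rightarrow> bool" where
  "whynot_env \<Gamma> \<longleftrightarrow> (\<forall>A \<in># \<Gamma>. \<exists>B. A = WhyNot B)"

inductive cll :: "env \<Rightarrow> bool" where
  cll_ax: "cll {#dual A, A#}"
| cll_cut: "cll (add_mset A \<Gamma>) \<Longrightarrow> cll (add_mset (dual A) \<Delta>) \<Longrightarrow> cll (\<Gamma> + \<Delta>)"
| cll_tensor: "cll (add_mset A \<Gamma>) \<Longrightarrow> cll (add_mset B \<Delta>) \<Longrightarrow> cll (add_mset (Tensor A B) (\<Gamma> + \<Delta>))"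
| cll_par: "cll (add_mset A (add_mset B \<Gamma>)) \<Longrightarrow> cll (add_mset (Par A B) \<Gamma>)"
| cll_one: "cll {#One#}"
| cll_bot: "cll \<Gamma> \<Longrightarrow> cll (add_mset Bot \<Gamma>)"
| cll_plus1: "cll (add_mset A \<Gamma>) \<Longrightarrow> cll (add_mset (Plus A B) \<Gamma>)"
| cll_plus2: "cll (add_mset B \<Gamma>) \<Longrightarrow> cll (add_mset (Plus A B) \<Gamma>)"
| cll_with: "cll (add_mset A \<Gamma>) \<Longrightarrow> cll (add_mset B \<Gamma>) \<Longrightarrow> cll (add_mset (With A B) \<Gamma>)"
| cll_ofcourse: "whynot_env \<Gamma> \<Longrightarrow> cll (add_mset A \<Gamma>) \<Longrightarrow> cll (add_mset (OfCourse A) \<Gamma>)"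
| cll_whynot: "cll (add_mset A \<Gamma>) \<Longrightarrow> cll (add_mset (WhyNot A) \<Gamma>)"
| cll_weaken: "cll \<Gamma> \<Longrightarrow> cll (add_mset (WhyNot A) \<Gamma>)"
| cll_contract: "cll (add_mset (WhyNot A) (add_mset (WhyNot A) \<Gamma>)) \<Longrightarrow> cll (add_mset (WhyNot A) \<Gamma>)"

inductive hcp :: "hyperenv \<Rightarrow> bool" where
  hcp_ax: "hcp {#{#dual A, A#}#}"
| hcp_cut: "hcp (\<G> + {#add_mset A \<Gamma>, add_mset (dual A) \<Delta>#}) \<Longrightarrow> hcp (\<G> + {#\<Gamma> + \<Delta>#})"
| hcp_mix: "hcp \<G> \<Longrightarrow> hcp \<H> \<Longrightarrow> hcp (\<G> + \<H>)"
| hcp_mix0: "hcp {#}"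
| hcp_tensor: "hcp (\<G> + {#add_mset A \<Gamma>, add_mset B \<Delta>#}) \<Longrightarrow> hcp (\<G> + {#add_mset (Tensor A B) (\<Gamma> + \<Delta>)#})"
| hcp_one: "hcp \<G> \<Longrightarrow> hcp (\<G> + {#{#One#}#})"
| hcp_par: "hcp (\<G> + {#add_mset A (add_mset B \<Gamma>)#}) \<Longrightarrow> hcp (\<G> + {#add_mset (Par A B) \<Gamma>#})"
| hcp_bot: "hcp (\<G> + {#\<Gamma>#}) \<Longrightarrow> hcp (\<G> + {#add_mset Bot \<Gamma>#})"
| hcp_plus1: "hcp (\<G> + {#add_mset A \<Gamma>#}) \<Longrightarrow> hcp (\<G> + {#add_mset (Plus A B) \<Gamma>#})"
| hcp_plus2: "hcp (\<G> + {#add_mset B \<Gamma>#}) \<Longrightarrow> hcp (\<G> + {#add_mset (Plus A B) \<Gamma>#})"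
| hcp_with: "hcp {#add_mset A \<Gamma>#} \<Longrightarrow> hcp {#add_mset B \<Gamma>#} \<Longrightarrow> hcp {#add_mset (With A B) \<Gamma>#}"
| hcp_ofcourse: "whynot_env \<Gamma> \<Longrightarrow> hcp {#add_mset A \<Gamma>#} \<Longrightarrow> hcp {#add_mset (OfCourse A) \<Gamma>#}"
| hcp_whynot: "hcp (\<G> + {#add_mset A \<Gamma>#}) \<Longrightarrow> hcp (\<G> + {#add_mset (WhyNot A) \<Gamma>#})"
| hcp_weaken: "hcp (\<G> + {#\<Gamma>#}) \<Longrightarrow> hcp (\<G> + {#add_mset (WhyNot A) \<Gamma>#})"
| hcp_contract: "hcp (\<G> + {#add_mset (WhyNot A) (add_mset (WhyNot A) \<Gamma>)#}) \<Longrightarrow> hcp (\<G> + {#add_mset (WhyNot A) \<Gamma>#})"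

end

theory Submission
  imports Defs
begin

text \<open>Induction on the CLL derivation: each CLL rule is simulated by its HCP counterpart in an
  empty hyperenvironment context. Only cut and tensor differ in shape: HCP wants one premise with
  two components, and H-Mix builds it from the two derivations.\<close>

text \<open>The summand \<open>{#}\<close> is kept so that the result unifies with the premises of
  \<open>hcp_cut\<close> and \<open>hcp_tensor\<close> at an empty context.\<close>

lemma hcp_mix_singletons:
  assumes "hcp {#\<Gamma>#}" and "hcp {#\<Delta>#}"
  shows "hcp ({#} + {#\<Gamma>, \<Delta>#})"
  using hcp_mix[OF assms] by (simp add: add_mset_commute)

theorem theorem2p5:
  fixes \<Gamma> :: env
  assumes "cll \<Gamma>"
  shows "hcp {#\<Gamma>#}"
  using assms
proof (induction rule: cll.induct)
  case (cll_ax A)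
  show ?case by (rule hcp_ax)
next
  case (cll_cut A \<Gamma> \<Delta>)
  show ?case using hcp_cut[OF hcp_mix_singletons[OF cll_cut.IH]] by simp
next
  case (cll_tensor A \<Gamma> B \<Delta>)
  show ?case using hcp_tensor[OF hcp_mix_singletons[OF cll_tensor.IH]] by simp
next
  case (cll_par A B \<Gamma>)
  then show ?case using hcp_par[of "{#}"] by simp
next
  case cll_one
  \<comment> \<open>H-Mix0 supplies the empty hyperenvironment that the HCP rule for
    \<open>One\<close> extends.\<close>
  show ?case using hcp_one[OF hcp_mix0] by simp
next
  case (cll_bot \<Gamma>)
  then show ?case using hcp_bot[of "{#}"] by simp
next
  case (cll_plus1 A \<Gamma> B)
  then show ?case using hcp_plus1[of "{#}"] by simp
next
  case (cll_plus2 B \<Gamma> A)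
  then show ?case using hcp_plus2[of "{#}"] by simp
next
  case (cll_with A \<Gamma> B)
  then show ?case by (intro hcp_with)
next
  case (cll_ofcourse \<Gamma> A)
  then show ?case by (intro hcp_ofcourse)
next
  case (cll_whynot A \<Gamma>)
  then show ?case using hcp_whynot[of "{#}"] by simp
next
  case (cll_weaken \<Gamma> A)
  then show ?case using hcp_weaken[of "{#}"] by simp
next
  case (cll_contract A \<Gamma>)
  then show ?case using hcp_contract[of "{#}"] by simp
qed

end
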